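(* Let $\alpha\in[0,1)$, $\beta\in[0,1]$, $\tau\in\mathbb{C}^*=\mathbb{C}\setminus\{0\}$, and let $f\in A$, $f(z)=z+\sum_{n=2}^{\infty}a_nz^n$ with $a_n\in\mathbb{C}$. Then the function $f$ belongs to the class $S^*C(\alpha,\beta;\tau)$ if the following condition is satisfied: $$\sum_{n=2}^{\infty}\left[n+(1-\alpha)|\tau|-1\right]\left[1+(n-1)\beta\right]|a_n|\le(1-\alpha)|\tau|.$$ The result is sharp for the functions $$f_n(z)=z+\frac{(1-\alpha)|\tau|}{\left[n+(1-\alpha)|\tau|-1\right]\left[1+(n-1)\beta\right]}z^n,\quad z\in U,\ n=2,3,\ldots.$$
   Context: $U=\{z\in\mathbb{C}:|z|<1\}$ is the open unit disk. $A$ is the class of analytic functions $f$ on $U$ normalized by $f(0)=0=f'(0)-1$, i.e. of the form $f(z)=z+\sum_{n=2}^{\infty}a_nz^n$, $a_n\in\mathbb{C}$. $S$ is the class of all functions in $A$ that are univalent in $U$. For $\alpha\in[0,1)$, $\beta\in[0,1]$, $\tau\in\mathbb{C}^*=\mathbb{C}\setminus\{0\}$, a function $f\in S$ is said to be in the class $S^*C(\alpha,\beta;\tau)$ if $$\operatorname{Re}\left\{1+\frac{1}{\tau}\left[\frac{zf'(z)+\beta z^2f''(z)}{\beta zf'(z)+(1-\beta)f(z)}-1\right]\right\}>\alpha,\quad z\in U.$$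
   Formalization: Univalence can fail (α=β=0, τ=3, f_2), so membership is proved for univalent f, or if (1-α)|τ|(1-β)≤1+β; the inequality holds for all f. Each f_n gives equality; its coefficient is shown best possible for τ>0 only (false otherwise); the bound (1-α)|τ| is best for every τ. *)

theory Defs
  imports "HOL-Complex_Analysis.Complex_Analysis"
begin

abbreviation unit_disk :: "complex set" where
  "unit_disk \<equiv> ball 0 1"

definition class_A :: "(complex \<Rightarrow> complex) set" where
  "class_A = {f. f holomorphic_on unit_disk \<and> f 0 = 0 \<and> deriv f 0 = 1}"

definition class_S :: "(complex \<Rightarrow> complex) set" where
  "class_S = {f \<in> class_A. inj_on f unit_disk}"

definition has_coeffs :: "(complex \<Rightarrow> complex) \<Rightarrow> (nat \<Rightarrow> complex) \<Rightarrow> bool" where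
  \<comment> \<open>$f(z) = z + \sum_{n \ge 2} a_n z^n$ on the disk; \<open>a 0\<close> and \<open>a 1\<close> play no role\<close>
  "has_coeffs f a \<longleftrightarrow> (\<forall>z\<in>unit_disk. (\<lambda>k. a (k + 2) * z ^ (k + 2)) sums (f z - z))"

definition SC_num :: "real \<Rightarrow> (complex \<Rightarrow> complex) \<Rightarrow> complex \<Rightarrow> complex" where
  "SC_num \<beta> f z = z * deriv f z + of_real \<beta> * z\<^sup>2 * deriv (deriv f) z"

definition SC_den :: "real \<Rightarrow> (complex \<Rightarrow> complex) \<Rightarrow> complex \<Rightarrow> complex" where
  "SC_den \<beta> f z = of_real \<beta> * z * deriv f z + (1 - of_real \<beta>) * f z"

text \<open>
  At the origin the quotient is $0/0$ with a removable singularity of value 1, for every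
  normalized function; this value is filled in, since HOL would give \<open>0 / 0 = 0\<close>.
\<close>

definition SC_quot :: "real \<Rightarrow> (complex \<Rightarrow> complex) \<Rightarrow> complex \<Rightarrow> complex" where
  "SC_quot \<beta> f z = (if z = 0 then 1 else SC_num \<beta> f z / SC_den \<beta> f z)"

text \<open>
  The defining inequality. It presupposes that the quotient is defined on the punctured disk,
  which has to be said explicitly because division is total in HOL.
\<close>

definition SC_ineq :: "real \<Rightarrow> real \<Rightarrow> complex \<Rightarrow> (complex \<Rightarrow> complex) \<Rightarrow> bool" where
  "SC_ineq \<alpha> \<beta> \<tau> f \<longleftrightarrow>
     (\<forall>z\<in>unit_disk. (z \<noteq> 0 \<longrightarrow> SC_den \<beta> f z \<noteq> 0) \<and>
        Re (1 + 1 / \<tau> * (SC_quot \<beta> f z - 1)) > \<alpha>)"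

definition class_SC :: "real \<Rightarrow> real \<Rightarrow> complex \<Rightarrow> (complex \<Rightarrow> complex) set" where
  "class_SC \<alpha> \<beta> \<tau> = {f \<in> class_S. SC_ineq \<alpha> \<beta> \<tau> f}"

definition weight :: "real \<Rightarrow> real \<Rightarrow> complex \<Rightarrow> nat \<Rightarrow> real" where
  "weight \<alpha> \<beta> \<tau> n = (real n + (1 - \<alpha>) * cmod \<tau> - 1) * (1 + (real n - 1) * \<beta>)"

definition extremal :: "real \<Rightarrow> real \<Rightarrow> complex \<Rightarrow> nat \<Rightarrow> complex \<Rightarrow> complex" where
  "extremal \<alpha> \<beta> \<tau> n z = z + of_real ((1 - \<alpha>) * cmod \<tau> / weight \<alpha> \<beta> \<tau> n) * z ^ n"

text \<open>
  The coefficient condition does not force univalence when $(1-\alpha)|\tau|$ is large: if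
  $(1-\alpha)|\tau|(1-\beta) > 1+\beta$, the function $f_2$, which satisfies the condition with
  equality, has $a_2 > 1/2$ and is not univalent. In the complementary range the condition
  implies $\sum n|a_n| \le 1$, hence univalence.
\<close>

lemma extremal_2_not_univalent:
  assumes "\<alpha> < 1" "0 \<le> \<beta>" "\<tau> \<noteq> 0"
    and large: "(1 - \<alpha>) * cmod \<tau> * (1 - \<beta>) > 1 + \<beta>"
  shows "extremal \<alpha> \<beta> \<tau> 2 \<notin> class_S"
proof
  assume "extremal \<alpha> \<beta> \<tau> 2 \<in> class_S"
  then have inj: "inj_on (extremal \<alpha> \<beta> \<tau> 2) unit_disk"
    by (simp add: class_S_def)
  define c where "c = (1 - \<alpha>) * cmod \<tau>"
  have c: "c > 0" using assms by (simp add: c_def)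
  define t where "t = c / ((1 + c) * (1 + \<beta>))"
  have f: "extremal \<alpha> \<beta> \<tau> 2 z = z + of_real t * z\<^sup>2" for z
    by (simp add: extremal_def weight_def t_def c_def algebra_simps)
  have "2 * c > (1 + c) * (1 + \<beta>)"
    using large unfolding c_def [symmetric] by (simp add: algebra_simps)
  moreover have "(1 + c) * (1 + \<beta>) > 0" using c assms by simp
  ultimately have t: "t > 1 / 2" by (simp add: t_def field_simps)
  define p where "p = 1 / (2 * t)"
  have p: "0 < p" "p < 1" "2 * t * p = 1" using t by (auto simp: p_def field_simps)
  define d where "d = (1 - p) / 2"
  have d: "0 < d" "d < 1" "p + d < 1" using p by (auto simp: d_def field_simps)
  have eq: "- (p + d) + t * (p + d)\<^sup>2 = - (p - d) + t * (p - d)\<^sup>2"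
  proof -
    have "- (p + d) + t * (p + d)\<^sup>2 - (- (p - d) + t * (p - d)\<^sup>2) = 2 * d * (2 * t * p - 1)"
      by (simp add: power2_eq_square algebra_simps)
    then show ?thesis using p by simp
  qed
  have ev: "extremal \<alpha> \<beta> \<tau> 2 (of_real (- x)) = of_real (- x + t * x\<^sup>2)" for x
    by (simp add: f)
  have "extremal \<alpha> \<beta> \<tau> 2 (of_real (- (p + d))) = extremal \<alpha> \<beta> \<tau> 2 (of_real (- (p - d)))"
    unfolding ev eq ..
  moreover have "complex_of_real (- (p + d)) \<in> unit_disk" "complex_of_real (- (p - d)) \<in> unit_disk"
    using p d by (auto simp only: mem_ball dist_0_norm norm_of_real abs_less_iff)
  ultimately have "complex_of_real (- (p + d)) = of_real (- (p - d))"
    using inj by (auto dest: inj_onD)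
  then have "- (p + d) = - (p - d)" by (simp only: of_real_eq_iff)
  then show False using d by simp
qed

end

theory Submission
  imports Defs
begin

text \<open>
  Put \<open>c = (1 - \<alpha>)|\<tau>|\<close> and \<open>u\<^sub>n = 1 + (n - 1)\<beta>\<close>. Numerator and denominator of the quotient
  are \<open>z + \<Sum> n u\<^sub>n a\<^sub>n z\<^sup>n\<close> and \<open>z + \<Sum> u\<^sub>n a\<^sub>n z\<^sup>n\<close>, so the coefficient condition makes their
  difference smaller in modulus than \<open>c\<close> times the denominator; hence \<open>|Q - 1| < c\<close>.
  If \<open>c(1 - \<beta>) \<le> 1 + \<beta>\<close>, then \<open>c n\<close> is at most the \<open>n\<close>-th weight, so \<open>\<Sum> n|a\<^sub>n| \<le> 1\<close> and
  \<open>f\<close> is univalent.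
  For \<open>z + t z\<^sup>n\<close> the quotient is a Moebius function of \<open>z\<^sup>n\<^sup>-\<^sup>1\<close>, which can be solved explicitly
  for \<open>Q - 1 = -c \<tau>/|\<tau>|\<close>. If \<open>\<tau> > 0\<close>, the solution lies in the disk as soon as \<open>t\<close> exceeds the
  extremal coefficient; for arbitrary \<open>\<tau>\<close> this holds only asymptotically, so \<open>n\<close> is taken large.
\<close>

section \<open>Power series of the numerator and denominator\<close>

lemma has_coeffs_deriv_sums:
  assumes hol: "f holomorphic_on unit_disk" and co: "has_coeffs f a" and z: "z \<in> unit_disk"
  shows "(\<lambda>k. of_nat (k + 2) * a (k + 2) * z ^ (k + 1)) sums (deriv f z - 1)"
    and "(\<lambda>k. of_nat (k + 2) * of_nat (k + 1) * a (k + 2) * z ^ k) sums deriv (deriv f) z"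
proof -
  \<comment> \<open>Zeros at the indices 0 and 1 turn the shifted series into a full power series
    for \<open>f w - w\<close>, to which termwise differentiation applies.\<close>
  define C where "C n = (if n < 2 then 0 else a n)" for n
  have f_sums: "(\<lambda>n. C n * w ^ n) sums (f w - w)" if "norm w < 1" for w
    using co that sums_zero_iff_shift [of 2 "\<lambda>n. C n * w ^ n" "f w - w"]
    by (simp add: has_coeffs_def C_def)
  have f_deriv: "((\<lambda>w. f w - w) has_field_derivative (deriv f w - 1)) (at w)" if "norm w < 1" for w
    using that by (auto intro!: derivative_eq_intros holomorphic_derivI [OF hol])
  have f'_sums: "(\<lambda>n. diffs C n * w ^ n) sums (deriv f w - 1)" if "norm w < 1" for w
    using termdiffs_sums_strong [OF f_sums f_deriv] that by blast
  have f'_deriv: "((\<lambda>w. deriv f w - 1) has_field_derivative deriv (deriv f) w) (at w)"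
    if "norm w < 1" for w
    using that holomorphic_derivI [OF holomorphic_deriv [OF hol]]
    by (auto intro!: derivative_eq_intros)
  have f''_sums: "(\<lambda>n. diffs (diffs C) n * w ^ n) sums deriv (deriv f) w" if "norm w < 1" for w
    using termdiffs_sums_strong [OF f'_sums f'_deriv] that by blast
  have z1: "norm z < 1" using z by simp
  show "(\<lambda>k. of_nat (k + 2) * a (k + 2) * z ^ (k + 1)) sums (deriv f z - 1)"
    \<comment> \<open>Since \<open>C 1 = 0\<close>, the series \<open>diffs C\<close> still has one
      vanishing initial term, hence the shift by 1; the second derivative starts at index 0 with
      \<open>2 * a 2\<close>.\<close>
    using f'_sums [OF z1] sums_zero_iff_shift [of 1 "\<lambda>n. diffs C n * z ^ n" "deriv f z - 1"]
    by (simp add: diffs_def C_def)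
  show "(\<lambda>k. of_nat (k + 2) * of_nat (k + 1) * a (k + 2) * z ^ k) sums deriv (deriv f) z"
    using f''_sums [OF z1] by (simp add: diffs_def C_def mult_ac)
qed

text \<open>With n = k + 2, the denominator has coefficient \<beta> n + 1 - \<beta> = 1 + (n - 1)
  \<beta>, and the numerator n + \<beta> n (n - 1), which is n times that. Subtracting leaves the
  factor n - 1 = k + 1.\<close>

lemma SC_sums:
  assumes hol: "f holomorphic_on unit_disk" and co: "has_coeffs f a" and z: "z \<in> unit_disk"
  shows SC_den_sums:
      "(\<lambda>k. of_real (1 + real (k + 1) * \<beta>) * a (k + 2) * z ^ (k + 2)) sums (SC_den \<beta> f z - z)"
    and SC_diff_sums:
      "(\<lambda>k. of_real (real (k + 1) * (1 + real (k + 1) * \<beta>)) * a (k + 2) * z ^ (k + 2))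
         sums (SC_num \<beta> f z - SC_den \<beta> f z)"
proof -
  note f0 = co [unfolded has_coeffs_def, rule_format, OF z]
  note f1 = has_coeffs_deriv_sums(1) [OF assms]
  note f2 = has_coeffs_deriv_sums(2) [OF assms]
  have "(\<lambda>k. of_real \<beta> * z * (of_nat (k + 2) * a (k + 2) * z ^ (k + 1))
          + (1 - of_real \<beta>) * (a (k + 2) * z ^ (k + 2)))
        sums (of_real \<beta> * z * (deriv f z - 1) + (1 - of_real \<beta>) * (f z - z))"
    by (intro sums_add sums_mult f0 f1)
  then show den:
    "(\<lambda>k. of_real (1 + real (k + 1) * \<beta>) * a (k + 2) * z ^ (k + 2)) sums (SC_den \<beta> f z - z)"
    by (simp add: SC_den_def algebra_simps)
  have "(\<lambda>k. z * (of_nat (k + 2) * a (k + 2) * z ^ (k + 1))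
          + of_real \<beta> * z\<^sup>2 * (of_nat (k + 2) * of_nat (k + 1) * a (k + 2) * z ^ k))
        sums (z * (deriv f z - 1) + of_real \<beta> * z\<^sup>2 * deriv (deriv f) z)"
    by (intro sums_add sums_mult f1 f2)
  from sums_diff [OF this den]
  show "(\<lambda>k. of_real (real (k + 1) * (1 + real (k + 1) * \<beta>)) * a (k + 2) * z ^ (k + 2))
         sums (SC_num \<beta> f z - SC_den \<beta> f z)"
    by (simp add: SC_num_def power2_eq_square algebra_simps)
qed

section \<open>From the coefficient condition to the defining inequality\<close>

text \<open>A number of modulus below 1 - \<alpha> has real part above \<alpha> - 1. Stating the
  bound in product form, with strict inequality, also forces the denominator to be nonzero.\<close>

lemma SC_ineqI:
  assumes \<tau>: "\<tau> \<noteq> 0" and \<alpha>: "\<alpha> < 1"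
    and bound: "\<And>z. z \<in> unit_disk \<Longrightarrow> z \<noteq> 0 \<Longrightarrow>
      cmod (SC_num \<beta> f z - SC_den \<beta> f z) < (1 - \<alpha>) * cmod \<tau> * cmod (SC_den \<beta> f z)"
  shows "SC_ineq \<alpha> \<beta> \<tau> f"
  unfolding SC_ineq_def
proof (intro ballI conjI impI)
  fix z :: complex assume z: "z \<in> unit_disk"
  have den: "SC_den \<beta> f z \<noteq> 0" if "z \<noteq> 0" using bound [OF z that] by auto
  then show "SC_den \<beta> f z \<noteq> 0" if "z \<noteq> 0" using that by blast
  have "cmod (SC_quot \<beta> f z - 1) < (1 - \<alpha>) * cmod \<tau>"
  proof (cases "z = 0")
    \<comment> \<open>The filled-in value 1 makes the left-hand side 0 here.\<close>
    case True
    then show ?thesis using \<tau> \<alpha> by (simp add: SC_quot_def)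
  next
    case False
    have "SC_quot \<beta> f z - 1 = (SC_num \<beta> f z - SC_den \<beta> f z) / SC_den \<beta> f z"
      using False den by (simp add: SC_quot_def field_simps)
    then show ?thesis
      using bound [OF z False] den [OF False] by (simp add: norm_divide pos_divide_less_eq)
  qed
  then have "cmod (1 / \<tau> * (SC_quot \<beta> f z - 1)) < 1 - \<alpha>"
    using \<tau> by (simp add: norm_mult norm_divide field_simps)
  then show "\<alpha> < Re (1 + 1 / \<tau> * (SC_quot \<beta> f z - 1))"
    using abs_Re_le_cmod [of "1 / \<tau> * (SC_quot \<beta> f z - 1)"] by simp
qed

lemma weight_pos:
  assumes "\<alpha> < 1" "0 \<le> \<beta>" "\<tau> \<noteq> 0" "n \<ge> 2"
  shows "weight \<alpha> \<beta> \<tau> n > 0"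
proof -
  have "(1 - \<alpha>) * cmod \<tau> > 0" using assms by simp
  moreover have "(real n - 1) * \<beta> \<ge> 0" using assms by simp
  ultimately show ?thesis
    using \<open>n \<ge> 2\<close> unfolding weight_def by (intro mult_pos_pos) linarith+
qed

lemma SC_ineq_if_coeffs:
  assumes \<alpha>: "\<alpha> < 1" and \<beta>: "0 \<le> \<beta>" and \<tau>: "\<tau> \<noteq> 0"
    and hol: "f holomorphic_on unit_disk" and co: "has_coeffs f a"
    and summ: "summable (\<lambda>k. weight \<alpha> \<beta> \<tau> (k + 2) * cmod (a (k + 2)))"
    and le: "(\<Sum>k. weight \<alpha> \<beta> \<tau> (k + 2) * cmod (a (k + 2))) \<le> (1 - \<alpha>) * cmod \<tau>"
  shows "SC_ineq \<alpha> \<beta> \<tau> f"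
proof (rule SC_ineqI [OF \<tau> \<alpha>])
  fix z :: complex assume z: "z \<in> unit_disk" and z0: "z \<noteq> 0"
  define c where "c = (1 - \<alpha>) * cmod \<tau>"
  have c: "c > 0" using \<alpha> \<tau> by (simp add: c_def)
  define d where "d k = of_real (1 + real (k + 1) * \<beta>) * a (k + 2) * z ^ (k + 2)" for k
  define e where "e k = of_real (real (k + 1) * (1 + real (k + 1) * \<beta>)) * a (k + 2) * z ^ (k + 2)"
    for k
  \<comment> \<open>This is where the weight comes from: with n = k + 2, it is (n - 1) + c times 1 +
    (n - 1) \<beta>.\<close>
  have weights: "cmod (e k) + c * cmod (d k)
      = weight \<alpha> \<beta> \<tau> (k + 2) * cmod (a (k + 2)) * cmod z ^ (k + 2)" for k
  proof -
    have u: "0 \<le> 1 + real (k + 1) * \<beta>" using \<beta> by simp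
    then have "0 \<le> real (k + 1) * (1 + real (k + 1) * \<beta>)" by (intro mult_nonneg_nonneg) auto
    then have "cmod (e k)
        = real (k + 1) * (1 + real (k + 1) * \<beta>) * cmod (a (k + 2)) * cmod z ^ (k + 2)"
      by (simp only: e_def norm_mult norm_power norm_of_real abs_of_nonneg)
    moreover have "cmod (d k) = (1 + real (k + 1) * \<beta>) * cmod (a (k + 2)) * cmod z ^ (k + 2)"
      using u by (simp only: d_def norm_mult norm_power norm_of_real abs_of_nonneg)
    moreover have "real (k + 2) - 1 = real (k + 1)" by simp
    ultimately show ?thesis by (simp only: weight_def c_def) (simp add: algebra_simps)
  qed
  \<comment> \<open>Every exponent is at least 2, so one factor \<open>(cmod z)\<^sup>2\<close> can
    be taken out of the whole series.\<close>
  have dom: "cmod (e k) + c * cmod (d k)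
      \<le> weight \<alpha> \<beta> \<tau> (k + 2) * cmod (a (k + 2)) * (cmod z)\<^sup>2" for k
    unfolding weights
    using z weight_pos [OF \<alpha> \<beta> \<tau>, of "k + 2"]
    by (intro mult_left_mono power_decreasing) auto
  have summ2: "summable (\<lambda>k. weight \<alpha> \<beta> \<tau> (k + 2) * cmod (a (k + 2)) * (cmod z)\<^sup>2)"
    by (intro summable_mult2 summ)
  have nonneg: "0 \<le> cmod (e k)" "0 \<le> c * cmod (d k)" for k
    using c by auto
  have se: "summable (\<lambda>k. cmod (e k))"
    by (rule summable_comparison_test' [OF summ2, of 0]) (use dom nonneg in \<open>smt (verit) real_norm_def\<close>)
  have "summable (\<lambda>k. c * cmod (d k))"
    by (rule summable_comparison_test' [OF summ2, of 0]) (use dom nonneg in \<open>smt (verit) real_norm_def\<close>)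
  then have sd: "summable (\<lambda>k. cmod (d k))"
    using c by (simp add: summable_cmult_iff)
  have "(\<Sum>k. cmod (e k)) + c * (\<Sum>k. cmod (d k)) = (\<Sum>k. cmod (e k) + c * cmod (d k))"
    by (simp only: suminf_mult [OF sd, symmetric] suminf_add [OF se summable_mult [OF sd]])
  also have "\<dots> \<le> (\<Sum>k. weight \<alpha> \<beta> \<tau> (k + 2) * cmod (a (k + 2)) * (cmod z)\<^sup>2)"
    using dom se sd summ2 by (intro suminf_le summable_add summable_mult)
  also have "\<dots> = (\<Sum>k. weight \<alpha> \<beta> \<tau> (k + 2) * cmod (a (k + 2))) * (cmod z)\<^sup>2"
    by (rule suminf_mult2 [symmetric, OF summ])
  also have "\<dots> \<le> c * (cmod z)\<^sup>2"
    using le by (intro mult_right_mono) (auto simp: c_def)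
  \<comment> \<open>Strictness comes from 0 < |z| < 1; the coefficient condition itself may hold
    with equality.\<close>
  also have "\<dots> < c * cmod z"
    using c z z0 by (simp add: power2_eq_square)
  finally have main: "(\<Sum>k. cmod (e k)) + c * (\<Sum>k. cmod (d k)) < c * cmod z" .
  have "e sums (SC_num \<beta> f z - SC_den \<beta> f z)"
    using SC_diff_sums [OF hol co z] by (simp add: e_def [abs_def])
  then have num: "cmod (SC_num \<beta> f z - SC_den \<beta> f z) \<le> (\<Sum>k. cmod (e k))"
    using summable_norm [OF se] sums_unique by metis
  have "d sums (SC_den \<beta> f z - z)"
    using SC_den_sums [OF hol co z] by (simp add: d_def [abs_def])
  then have "cmod (SC_den \<beta> f z - z) \<le> (\<Sum>k. cmod (d k))"
    using summable_norm [OF sd] sums_unique by metis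
  then have "cmod z - (\<Sum>k. cmod (d k)) \<le> cmod (SC_den \<beta> f z)"
    using norm_triangle_ineq4 [of "SC_den \<beta> f z" "SC_den \<beta> f z - z"] by simp
  then have "c * cmod z - c * (\<Sum>k. cmod (d k)) \<le> c * cmod (SC_den \<beta> f z)"
    using c by (simp flip: right_diff_distrib)
  then have "cmod (SC_num \<beta> f z - SC_den \<beta> f z) < c * cmod (SC_den \<beta> f z)"
    using num main by linarith
  then show "cmod (SC_num \<beta> f z - SC_den \<beta> f z) < (1 - \<alpha>) * cmod \<tau> * cmod (SC_den \<beta> f z)"
    by (simp add: c_def)
qed

section \<open>Univalence from the coefficient condition\<close>

text \<open>Rescaling by r reduces this to the closed unit disk: the powers contribute
  \<open>r ^ Suc m\<close> and \<open>z - w\<close> absorbs one factor r. The remaining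
  \<open>r ^ m\<close> later supplies the strict inequality.\<close>

lemma norm_power_diff_scaled:
  fixes z w :: complex
  assumes "cmod z \<le> r" "cmod w \<le> r" "0 < r"
  shows "cmod (z ^ Suc m - w ^ Suc m) \<le> real (Suc m) * r ^ m * cmod (z - w)"
proof -
  define x y where "x = z / of_real r" and "y = w / of_real r"
  have zw: "z = of_real r * x" "w = of_real r * y" using assms by (auto simp: x_def y_def)
  have "cmod x \<le> 1" "cmod y \<le> 1" using assms by (auto simp: x_def y_def norm_divide)
  then have "cmod (x ^ Suc m - y ^ Suc m) \<le> real (Suc m) * cmod (x - y)"
    by (rule norm_power_diff)
  then have "r ^ Suc m * cmod (x ^ Suc m - y ^ Suc m) \<le> r ^ Suc m * (real (Suc m) * cmod (x - y))"
    using assms by (intro mult_left_mono) auto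
  moreover have "z ^ Suc m - w ^ Suc m = of_real (r ^ Suc m) * (x ^ Suc m - y ^ Suc m)"
    unfolding zw by (simp add: power_mult_distrib algebra_simps)
  moreover have "z - w = of_real r * (x - y)" unfolding zw by (simp add: algebra_simps)
  ultimately show ?thesis using assms by (simp add: norm_mult norm_power mult_ac)
qed

text \<open>On a closed disk of radius r < 1, the map \<open>f z - z\<close> is Lipschitz with
  constant at most r, hence a strict contraction. Equal values of f at distinct points would make it
  preserve their distance.\<close>

lemma inj_on_if_coeffs:
  assumes co: "has_coeffs f a"
    and summ: "summable (\<lambda>k. real (k + 2) * cmod (a (k + 2)))"
    and le: "(\<Sum>k. real (k + 2) * cmod (a (k + 2))) \<le> 1"
  shows "inj_on f unit_disk"
proof (rule inj_onI, rule ccontr)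
  fix z w :: complex
  assume z: "z \<in> unit_disk" and w: "w \<in> unit_disk" and eq: "f z = f w" and neq: "z \<noteq> w"
  define r where "r = max (cmod z) (cmod w)"
  have r: "cmod z \<le> r" "cmod w \<le> r" "0 < r" "r < 1"
    using z w neq by (auto simp: r_def less_max_iff_disj)
  define d where "d k = a (k + 2) * z ^ (k + 2) - a (k + 2) * w ^ (k + 2)" for k
  have d: "d sums (w - z)"
    using sums_diff [OF co [unfolded has_coeffs_def, rule_format, OF z]
        co [unfolded has_coeffs_def, rule_format, OF w]] eq
    by (simp add: d_def [abs_def])
  have dom: "cmod (d k) \<le> real (k + 2) * cmod (a (k + 2)) * (r * cmod (z - w))" for k
  proof -
    have "cmod (z ^ (k + 2) - w ^ (k + 2)) \<le> real (k + 2) * r ^ (k + 1) * cmod (z - w)"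
      using norm_power_diff_scaled [OF r(1-3), of "k + 1"] by simp
    \<comment> \<open>A single factor r, common to all terms, is enough for the contraction.\<close>
    also have "\<dots> \<le> real (k + 2) * r * cmod (z - w)"
      using r power_decreasing [of 1 "k + 1" r] by (intro mult_right_mono mult_left_mono) auto
    finally have "cmod (a (k + 2)) * cmod (z ^ (k + 2) - w ^ (k + 2))
        \<le> cmod (a (k + 2)) * (real (k + 2) * r * cmod (z - w))"
      by (intro mult_left_mono) auto
    moreover have "d k = a (k + 2) * (z ^ (k + 2) - w ^ (k + 2))"
      unfolding d_def by (rule right_diff_distrib [symmetric])
    ultimately show ?thesis by (simp only: norm_mult mult_ac)
  qed
  have summ2: "summable (\<lambda>k. real (k + 2) * cmod (a (k + 2)) * (r * cmod (z - w)))"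
    by (intro summable_mult2 summ)
  have sd: "summable (\<lambda>k. cmod (d k))"
    by (rule summable_comparison_test' [OF summ2, of 0]) (use dom in auto)
  have "cmod (w - z) \<le> (\<Sum>k. cmod (d k))"
    using summable_norm [OF sd] sums_unique [OF d] by simp
  also have "\<dots> \<le> (\<Sum>k. real (k + 2) * cmod (a (k + 2)) * (r * cmod (z - w)))"
    by (intro suminf_le dom sd summ2)
  also have "\<dots> = (\<Sum>k. real (k + 2) * cmod (a (k + 2))) * (r * cmod (z - w))"
    by (rule suminf_mult2 [symmetric, OF summ])
  also have "\<dots> \<le> 1 * (r * cmod (z - w))"
    using le r by (intro mult_right_mono) auto
  also have "\<dots> < cmod (z - w)" using r neq by simp
  finally show False by (simp add: norm_minus_commute)
qed

text \<open>The difference of the two sides factors, and its second factor is smallest at n = 2,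
  where it is 1 + \<beta> - c (1 - \<beta>). The range condition is thus exactly the case n =
  2.\<close>

lemma weight_ge:
  assumes \<beta>: "0 \<le> \<beta>" and n: "n \<ge> 2"
    and range: "(1 - \<alpha>) * cmod \<tau> * (1 - \<beta>) \<le> 1 + \<beta>"
  shows "(1 - \<alpha>) * cmod \<tau> * real n \<le> weight \<alpha> \<beta> \<tau> n"
proof -
  define c where "c = (1 - \<alpha>) * cmod \<tau>"
  have "weight \<alpha> \<beta> \<tau> n - c * real n = (real n - 1) * (1 + (real n - 1) * \<beta> - c * (1 - \<beta>))"
    by (simp add: weight_def c_def algebra_simps)
  moreover have "1 * \<beta> \<le> (real n - 1) * \<beta>" using \<beta> n by (intro mult_right_mono) auto
  then have "(real n - 1) * (1 + (real n - 1) * \<beta> - c * (1 - \<beta>)) \<ge> 0"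
    using range n by (intro mult_nonneg_nonneg) (auto simp: c_def)
  ultimately show ?thesis by (simp add: c_def)
qed

lemma inj_on_if_weighted_coeffs:
  assumes \<alpha>: "\<alpha> < 1" and \<beta>: "0 \<le> \<beta>" and \<tau>: "\<tau> \<noteq> 0" and co: "has_coeffs f a"
    and range: "(1 - \<alpha>) * cmod \<tau> * (1 - \<beta>) \<le> 1 + \<beta>"
    and summ: "summable (\<lambda>k. weight \<alpha> \<beta> \<tau> (k + 2) * cmod (a (k + 2)))"
    and le: "(\<Sum>k. weight \<alpha> \<beta> \<tau> (k + 2) * cmod (a (k + 2))) \<le> (1 - \<alpha>) * cmod \<tau>"
  shows "inj_on f unit_disk"
proof -
  define c where "c = (1 - \<alpha>) * cmod \<tau>"
  have c: "c > 0" using \<alpha> \<tau> by (simp add: c_def)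
  have dom: "c * (real (k + 2) * cmod (a (k + 2))) \<le> weight \<alpha> \<beta> \<tau> (k + 2) * cmod (a (k + 2))" for k
    using mult_right_mono [OF weight_ge [OF \<beta> _ range, of "k + 2"], of "cmod (a (k + 2))"]
    by (simp add: c_def mult_ac)
  have sc: "summable (\<lambda>k. c * (real (k + 2) * cmod (a (k + 2))))"
    by (rule summable_comparison_test' [OF summ, of 0]) (use dom c in \<open>auto simp: abs_mult\<close>)
  then have s: "summable (\<lambda>k. real (k + 2) * cmod (a (k + 2)))"
    using c by (simp only: summable_cmult_iff) simp
  have "c * (\<Sum>k. real (k + 2) * cmod (a (k + 2))) = (\<Sum>k. c * (real (k + 2) * cmod (a (k + 2))))"
    by (rule suminf_mult [symmetric, OF s])
  also have "\<dots> \<le> c"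
    using suminf_le [OF dom sc summ] le by (simp add: c_def)
  finally have "(\<Sum>k. real (k + 2) * cmod (a (k + 2))) \<le> 1"
    using c by simp
  with co s show ?thesis by (rule inj_on_if_coeffs)
qed

section \<open>The functions \<open>z + t * z ^ n\<close>\<close>

lemma binomial_class_A:
  assumes "n \<ge> 2"
  shows "(\<lambda>z. z + t * z ^ n) \<in> class_A"
proof -
  have "((\<lambda>z. z + t * z ^ n) has_field_derivative 1) (at 0)"
    using assms by (auto intro!: derivative_eq_intros)
  then have "deriv (\<lambda>z. z + t * z ^ n) 0 = 1" by (rule DERIV_imp_deriv)
  then show ?thesis
    using assms by (auto simp: class_A_def intro!: holomorphic_intros)
qed

lemma sums_single_shifted:
  fixes h :: "nat \<Rightarrow> 'a :: real_normed_vector"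
  assumes "n \<ge> 2" and "\<And>k. k \<noteq> n \<Longrightarrow> h k = 0"
  shows "(\<lambda>k. h (k + 2)) sums h n"
proof -
  have "(\<lambda>k. h (k + 2)) = (\<lambda>k. if k = n - 2 then h (k + 2) else 0)"
    using assms by (auto simp: fun_eq_iff)
  then show ?thesis
    using sums_single [of "n - 2" "\<lambda>k. h (k + 2)"] le_add_diff_inverse2 [OF assms(1)] by simp
qed

lemma binomial_has_coeffs:
  assumes "n \<ge> 2"
  shows "has_coeffs (\<lambda>z. z + t * z ^ n) (\<lambda>k. if k = n then t else 0)"
  unfolding has_coeffs_def
proof
  fix z :: complex
  show "(\<lambda>k. (if k + 2 = n then t else 0) * z ^ (k + 2)) sums (z + t * z ^ n - z)"
    using sums_single_shifted [OF assms, of "\<lambda>k. (if k = n then t else 0) * z ^ k"] by simp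
qed

lemma binomial_weight_sums:
  assumes "n \<ge> 2"
  shows "(\<lambda>k. weight \<alpha> \<beta> \<tau> (k + 2) * cmod (if k + 2 = n then t else 0)) sums
    (weight \<alpha> \<beta> \<tau> n * cmod t)"
  using sums_single_shifted [OF assms, of "\<lambda>k. weight \<alpha> \<beta> \<tau> k * cmod (if k = n then t else 0)"]
  by simp

text \<open>Both formulas are read off from the general series by uniqueness of sums, since only the
  n-th coefficient survives; no derivative has to be computed.\<close>

lemma SC_binomial:
  fixes \<beta> :: real and t z :: complex
  assumes n: "n \<ge> 2" and z: "z \<in> unit_disk"
  defines "u \<equiv> complex_of_real (1 + (real n - 1) * \<beta>)"
  shows "SC_den \<beta> (\<lambda>z. z + t * z ^ n) z = z + u * t * z ^ n"
    and "SC_num \<beta> (\<lambda>z. z + t * z ^ n) z - SC_den \<beta> (\<lambda>z. z + t * z ^ n) z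
      = of_real (real n - 1) * u * t * z ^ n"
proof -
  let ?b = "\<lambda>k. if k = n then t else 0" and ?f = "\<lambda>z. z + t * z ^ n"
  have hol: "?f holomorphic_on unit_disk" by (intro holomorphic_intros)
  note co = binomial_has_coeffs [OF n, of t]
  have "(\<lambda>k. of_real (1 + (real (k + 2) - 1) * \<beta>) * ?b (k + 2) * z ^ (k + 2)) sums (u * t * z ^ n)"
    using sums_single_shifted [OF n, of "\<lambda>k. of_real (1 + (real k - 1) * \<beta>) * ?b k * z ^ k"]
    by (simp add: u_def)
  then have "(\<lambda>k. of_real (1 + real (k + 1) * \<beta>) * ?b (k + 2) * z ^ (k + 2)) sums (u * t * z ^ n)"
    by (simp add: algebra_simps)
  from sums_unique2 [OF this SC_den_sums [OF hol co z]]
  show "SC_den \<beta> ?f z = z + u * t * z ^ n" by (simp add: algebra_simps)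
  have "(\<lambda>k. of_real ((real (k + 2) - 1) * (1 + (real (k + 2) - 1) * \<beta>)) * ?b (k + 2) * z ^ (k + 2))
      sums (of_real (real n - 1) * u * t * z ^ n)"
    using sums_single_shifted
      [OF n, of "\<lambda>k. of_real ((real k - 1) * (1 + (real k - 1) * \<beta>)) * ?b k * z ^ k"]
    by (simp add: u_def)
  then have "(\<lambda>k. of_real (real (k + 1) * (1 + real (k + 1) * \<beta>)) * ?b (k + 2) * z ^ (k + 2))
      sums (of_real (real n - 1) * u * t * z ^ n)"
    by (simp add: algebra_simps)
  from sums_unique2 [OF this SC_diff_sums [OF hol co z]]
  show "SC_num \<beta> ?f z - SC_den \<beta> ?f z = of_real (real n - 1) * u * t * z ^ n" by simp
qed

section \<open>Sharpness\<close>

text \<open>With \<zeta> = u t z^(n-1) and m = n - 1, the quotient minus 1 is m \<zeta> / (1 +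
  \<zeta>). It takes the value v at \<zeta> = v / (m - v), and \<open>small\<close> says that this
  \<zeta> comes from a point of the disk. \<open>Re_v\<close> places v outside the admissible
  half-plane.\<close>

lemma not_SC_ineq_binomial:
  assumes n: "n \<ge> 2" and \<beta>: "0 \<le> \<beta>" and v0: "v \<noteq> 0" and vn: "v \<noteq> of_real (real n - 1)"
    and small: "cmod (v / (of_real (real n - 1) - v)) < (1 + (real n - 1) * \<beta>) * cmod t"
    and Re_v: "Re (v / \<tau>) \<le> \<alpha> - 1"
  shows "\<not> SC_ineq \<alpha> \<beta> \<tau> (\<lambda>z. z + t * z ^ n)"
proof -
  let ?f = "\<lambda>z. z + t * z ^ n"
  define m where "m = complex_of_real (real n - 1)"
  define u where "u = complex_of_real (1 + (real n - 1) * \<beta>)"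
  \<comment> \<open>the solution of \<open>m \<zeta> / (1 + \<zeta>) = v\<close>\<close>
  define \<zeta> where "\<zeta> = v / (m - v)"
  have m0: "m \<noteq> 0" using n by (simp add: m_def)
  have mv: "m - v \<noteq> 0" using vn by (simp add: m_def)
  have \<zeta>1: "1 + \<zeta> = m / (m - v)" using mv by (simp add: \<zeta>_def field_simps)
  have \<zeta>0: "\<zeta> \<noteq> 0" using v0 mv by (simp add: \<zeta>_def)
  have "1 + (real n - 1) * \<beta> > 0" using n \<beta> by (simp add: add_pos_nonneg)
  then have cu: "cmod (u * t) = (1 + (real n - 1) * \<beta>) * cmod t"
    unfolding u_def norm_mult norm_of_real by simp
  have small': "cmod \<zeta> < cmod (u * t)"
    using small unfolding cu \<zeta>_def m_def .
  then have ut: "u * t \<noteq> 0" by auto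
  have "n - 1 \<noteq> 0" using n by simp
  \<comment> \<open>Any (n - 1)-th root will do; the right-hand side has modulus below 1, which puts
    z in the disk.\<close>
  then obtain z where z: "z ^ (n - 1) = \<zeta> / (u * t)"
    using exists_complex_root by metis
  have "cmod z ^ (n - 1) < 1"
    using arg_cong [OF z, of cmod] small' ut by (simp add: norm_power norm_divide)
  then have zd: "z \<in> unit_disk"
    using one_le_power [of "cmod z" "n - 1"] by (force simp: not_less [symmetric])
  have "z ^ (n - 1) \<noteq> 0" using z \<zeta>0 ut by simp
  then have z0: "z \<noteq> 0" using \<open>n - 1 \<noteq> 0\<close> by (auto simp: power_0_left)
  have zn: "u * t * z ^ n = z * \<zeta>"
  proof -
    have "z ^ n = z * z ^ (n - 1)" using n by (simp flip: power_Suc)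
    then show ?thesis using z ut by simp
  qed
  have den: "SC_den \<beta> ?f z = z * (1 + \<zeta>)"
    using SC_binomial(1) [OF n zd, of \<beta> t] zn unfolding u_def by (simp add: algebra_simps)
  have diff: "SC_num \<beta> ?f z - SC_den \<beta> ?f z = m * (z * \<zeta>)"
    using SC_binomial(2) [OF n zd, of \<beta> t] zn unfolding u_def m_def by (simp add: mult.assoc)
  \<comment> \<open>The quotient is therefore a genuine one at z, and the violation found below is
    not an artefact of division by zero.\<close>
  have den0: "SC_den \<beta> ?f z \<noteq> 0"
    using z0 m0 mv by (simp add: den \<zeta>1)
  have "SC_quot \<beta> ?f z - 1 = (SC_num \<beta> ?f z - SC_den \<beta> ?f z) / SC_den \<beta> ?f z"
    using z0 den0 by (simp add: SC_quot_def field_simps)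
  also have "\<dots> = m * \<zeta> / (1 + \<zeta>)"
    unfolding diff unfolding den using z0 by simp
  also have "\<dots> = v" unfolding \<zeta>1 using m0 mv by (simp add: \<zeta>_def)
  finally have "1 / \<tau> * (SC_quot \<beta> ?f z - 1) = v / \<tau>" by simp
  then have "Re (1 + 1 / \<tau> * (SC_quot \<beta> ?f z - 1)) = 1 + Re (v / \<tau>)"
    by (simp only: plus_complex.sel one_complex.sel)
  then have "Re (1 + 1 / \<tau> * (SC_quot \<beta> ?f z - 1)) \<le> \<alpha>"
    using Re_v by linarith
  then show ?thesis using zd unfolding SC_ineq_def by (meson not_less)
qed

text \<open>For the positive parameter |\<tau>|, the boundary value is v = -c. It points away from m
  = n - 1, so |m - v| = m + c is exactly the first factor of the weight, and \<open>small\<close>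
  becomes the assumption on t.\<close>

lemma coefficient_sharp:
  assumes \<alpha>: "\<alpha> < 1" and \<beta>: "0 \<le> \<beta>" and \<tau>: "\<tau> \<noteq> 0" and n: "n \<ge> 2"
    and t: "t > (1 - \<alpha>) * cmod \<tau> / weight \<alpha> \<beta> \<tau> n"
  shows "\<not> SC_ineq \<alpha> \<beta> (of_real (cmod \<tau>)) (\<lambda>z. z + of_real t * z ^ n)"
proof (rule not_SC_ineq_binomial [OF n \<beta>])
  define c where "c = (1 - \<alpha>) * cmod \<tau>"
  have c: "c > 0" using \<alpha> \<tau> by (simp add: c_def)
  let ?v = "- complex_of_real c"
  have nc: "real n - 1 + c > 0" using n c by simp
  show "?v \<noteq> 0" using c by simp
  have "- c \<noteq> real n - 1" using nc by linarith
  then show "?v \<noteq> of_real (real n - 1)" by (metis of_real_eq_iff of_real_minus)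
  have u: "1 + (real n - 1) * \<beta> > 0" using n \<beta> by (simp add: add_pos_nonneg)
  have w: "weight \<alpha> \<beta> \<tau> n = (real n - 1 + c) * (1 + (real n - 1) * \<beta>)"
    by (simp add: weight_def c_def)
  have wp: "weight \<alpha> \<beta> \<tau> n > 0" by (rule weight_pos [OF \<alpha> \<beta> \<tau> n])
  have tp: "t > 0" using t wp c by (smt (verit) c_def divide_pos_pos)
  have "c < weight \<alpha> \<beta> \<tau> n * t" using t wp by (simp add: c_def field_simps)
  then have "c / (real n - 1 + c) < (1 + (real n - 1) * \<beta>) * t"
    using nc unfolding w by (simp add: pos_divide_less_eq mult_ac)
  moreover have "?v / (of_real (real n - 1) - ?v) = of_real (- (c / (real n - 1 + c)))" by simp
  then have "cmod (?v / (of_real (real n - 1) - ?v)) = c / (real n - 1 + c)"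
    using c nc by (simp only: norm_of_real abs_minus_cancel abs_of_pos divide_pos_pos)
  ultimately show "cmod (?v / (of_real (real n - 1) - ?v))
      < (1 + (real n - 1) * \<beta>) * cmod (of_real t)"
    using tp by simp
  have "?v / of_real (cmod \<tau>) = of_real (- (1 - \<alpha>))" using \<tau> by (simp add: c_def)
  then show "Re (?v / of_real (cmod \<tau>)) \<le> \<alpha> - 1" by (simp only: Re_complex_of_real)
qed

text \<open>For general \<tau> the direction of v is prescribed, and only |m - v| \<ge> m - c is
  available. The loss (m + c) / (m - c) tends to 1, so K / c > 1 absorbs it for large m.\<close>

lemma bound_sharp:
  assumes \<alpha>: "\<alpha> < 1" and \<beta>: "0 \<le> \<beta>" and \<tau>: "\<tau> \<noteq> 0" and K: "K > (1 - \<alpha>) * cmod \<tau>"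
  obtains n where "n \<ge> 2"
    "\<not> SC_ineq \<alpha> \<beta> \<tau> (\<lambda>z. z + of_real (K / weight \<alpha> \<beta> \<tau> n) * z ^ n)"
proof -
  define c where "c = (1 - \<alpha>) * cmod \<tau>"
  have c: "c > 0" using \<alpha> \<tau> by (simp add: c_def)
  have Kc: "K > c" using K by (simp add: c_def)
  \<comment> \<open>The threshold is c (m + c) < K (m - c) solved for m; it also yields m >
    c.\<close>
  obtain m :: nat where m: "real m > c * (c + K) / (K - c)" using reals_Archimedean2 by blast
  have "c * (K - c) \<le> c * (c + K)" using c by (intro mult_left_mono) auto
  then have "c \<le> c * (c + K) / (K - c)" using Kc by (simp add: pos_le_divide_eq)
  then have mc: "real m > c" using m by linarith
  have mK: "c * (real m + c) < K * (real m - c)"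
    using m Kc by (simp add: pos_divide_less_eq algebra_simps)
  define n where "n = Suc m"
  have nm: "real n - 1 = real m" by (simp add: n_def)
  have n: "n \<ge> 2" using mc c by (cases m) (auto simp: n_def)
  \<comment> \<open>This equals -(1 - \<alpha>) \<tau>, so \<open>v / \<tau>\<close> is real and
    lies on the boundary of the half-plane.\<close>
  define v where "v = - (of_real c * sgn \<tau>)"
  have cv: "cmod v = c" using c \<tau> by (simp add: v_def norm_mult norm_sgn)
  have w: "weight \<alpha> \<beta> \<tau> n = (real m + c) * (1 + (real n - 1) * \<beta>)"
    by (simp add: weight_def c_def nm)
  have u: "1 + (real n - 1) * \<beta> > 0" using n \<beta> by (simp add: add_pos_nonneg)
  have wp: "weight \<alpha> \<beta> \<tau> n > 0" by (rule weight_pos [OF \<alpha> \<beta> \<tau> n])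
  have "\<not> SC_ineq \<alpha> \<beta> \<tau> (\<lambda>z. z + of_real (K / weight \<alpha> \<beta> \<tau> n) * z ^ n)"
  proof (rule not_SC_ineq_binomial [OF n \<beta>])
    show "v \<noteq> 0" using cv c by auto
    show "v \<noteq> of_real (real n - 1)"
      using cv mc unfolding nm by auto
    have "cmod (of_real (real m) - v) \<ge> real m - c"
      using norm_triangle_ineq2 [of "of_real (real m)" v] cv by simp
    then have "cmod (v / (of_real (real n - 1) - v)) \<le> c / (real m - c)"
      unfolding nm norm_divide cv using mc c by (intro divide_left_mono mult_pos_pos) auto
    also have "\<dots> < K / (real m + c)"
      using mK mc c by (simp add: field_simps)
    also have "\<dots> = (1 + (real n - 1) * \<beta>) * (K / weight \<alpha> \<beta> \<tau> n)"
      unfolding w using u by simp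
    also have "\<dots> = (1 + (real n - 1) * \<beta>) * cmod (of_real (K / weight \<alpha> \<beta> \<tau> n))"
      using Kc c wp by (simp only: norm_of_real) simp
    finally show "cmod (v / (of_real (real n - 1) - v))
      < (1 + (real n - 1) * \<beta>) * cmod (of_real (K / weight \<alpha> \<beta> \<tau> n))" .
    have "v / \<tau> = of_real (- (1 - \<alpha>))" using \<tau> by (simp add: v_def c_def sgn_eq)
    then show "Re (v / \<tau>) \<le> \<alpha> - 1" by (simp only: Re_complex_of_real)
  qed
  with n show ?thesis by (rule that)
qed

theorem theorem2p1:
  fixes \<alpha> \<beta> :: real and \<tau> :: complex
    and f :: "complex \<Rightarrow> complex" and a :: "nat \<Rightarrow> complex"
  assumes "0 \<le> \<alpha>" "\<alpha> < 1" and "0 \<le> \<beta>" "\<beta> \<le> 1" and "\<tau> \<noteq> 0"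
    and "f \<in> class_A" and "has_coeffs f a"
    and "summable (\<lambda>k. weight \<alpha> \<beta> \<tau> (k + 2) * cmod (a (k + 2)))"
    and "(\<Sum>k. weight \<alpha> \<beta> \<tau> (k + 2) * cmod (a (k + 2))) \<le> (1 - \<alpha>) * cmod \<tau>"
  shows "
    \<comment> \<open>membership; the coefficient condition alone yields univalence exactly in the stated range\<close>
      SC_ineq \<alpha> \<beta> \<tau> f \<and>
      (f \<in> class_S \<longrightarrow> f \<in> class_SC \<alpha> \<beta> \<tau>) \<and>
      ((1 - \<alpha>) * cmod \<tau> * (1 - \<beta>) \<le> 1 + \<beta> \<longrightarrow> f \<in> class_SC \<alpha> \<beta> \<tau>) \<and>
    \<comment> \<open>sharpness: each extremal function attains equality in the coefficient condition\<close>
      (\<forall>n\<ge>2. extremal \<alpha> \<beta> \<tau> n \<in> class_A \<and>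
         (\<exists>b. has_coeffs (extremal \<alpha> \<beta> \<tau> n) b \<and>
              (\<lambda>k. weight \<alpha> \<beta> \<tau> (k + 2) * cmod (b (k + 2))) sums ((1 - \<alpha>) * cmod \<tau>))) \<and>
    \<comment> \<open>no coefficient can be enlarged in a condition that involves only the modulus of \<open>\<tau>\<close>\<close>
      (\<forall>n\<ge>2. \<forall>t > (1 - \<alpha>) * cmod \<tau> / weight \<alpha> \<beta> \<tau> n.
         \<not> SC_ineq \<alpha> \<beta> (of_real (cmod \<tau>)) (\<lambda>z. z + of_real t * z ^ n)) \<and>
    \<comment> \<open>the bound on the right-hand side cannot be enlarged, for any \<open>\<tau>\<close>\<close>
      (\<forall>K > (1 - \<alpha>) * cmod \<tau>. \<exists>g b. g \<in> class_A \<and> has_coeffs g b \<and>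
         (\<lambda>k. weight \<alpha> \<beta> \<tau> (k + 2) * cmod (b (k + 2))) sums K \<and> \<not> SC_ineq \<alpha> \<beta> \<tau> g)"
proof (intro conjI)
  show ineq: "SC_ineq \<alpha> \<beta> \<tau> f"
    using assms by (intro SC_ineq_if_coeffs) (auto simp: class_A_def)
  then show "f \<in> class_S \<longrightarrow> f \<in> class_SC \<alpha> \<beta> \<tau>"
    by (simp add: class_SC_def)
  show "(1 - \<alpha>) * cmod \<tau> * (1 - \<beta>) \<le> 1 + \<beta> \<longrightarrow> f \<in> class_SC \<alpha> \<beta> \<tau>"
    using inj_on_if_weighted_coeffs assms ineq by (auto simp: class_SC_def class_S_def)
  show "\<forall>n\<ge>2. extremal \<alpha> \<beta> \<tau> n \<in> class_A \<and>
         (\<exists>b. has_coeffs (extremal \<alpha> \<beta> \<tau> n) b \<and>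
              (\<lambda>k. weight \<alpha> \<beta> \<tau> (k + 2) * cmod (b (k + 2))) sums ((1 - \<alpha>) * cmod \<tau>))"
  proof (intro allI impI)
    fix n :: nat assume n: "n \<ge> 2"
    define t where "t = (1 - \<alpha>) * cmod \<tau> / weight \<alpha> \<beta> \<tau> n"
    have w: "weight \<alpha> \<beta> \<tau> n > 0" using assms n by (intro weight_pos)
    have "t \<ge> 0" using w assms by (simp add: t_def)
    then have "cmod (of_real t) = t" by simp
    then have "weight \<alpha> \<beta> \<tau> n * cmod (of_real t) = (1 - \<alpha>) * cmod \<tau>"
      using w by (simp add: t_def)
    moreover have "extremal \<alpha> \<beta> \<tau> n = (\<lambda>z. z + of_real t * z ^ n)"
      by (simp add: fun_eq_iff extremal_def t_def)
    ultimately show "extremal \<alpha> \<beta> \<tau> n \<in> class_A \<and>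
         (\<exists>b. has_coeffs (extremal \<alpha> \<beta> \<tau> n) b \<and>
              (\<lambda>k. weight \<alpha> \<beta> \<tau> (k + 2) * cmod (b (k + 2))) sums ((1 - \<alpha>) * cmod \<tau>))"
      using binomial_class_A [OF n] binomial_has_coeffs [OF n, of "of_real t"]
        binomial_weight_sums [OF n, of \<alpha> \<beta> \<tau> "of_real t"]
      by (auto intro!: exI [of _ "\<lambda>k. if k = n then of_real t else 0"])
  qed
  show "\<forall>n\<ge>2. \<forall>t > (1 - \<alpha>) * cmod \<tau> / weight \<alpha> \<beta> \<tau> n.
         \<not> SC_ineq \<alpha> \<beta> (of_real (cmod \<tau>)) (\<lambda>z. z + of_real t * z ^ n)"
    using assms by (intro allI impI coefficient_sharp)
  show "\<forall>K > (1 - \<alpha>) * cmod \<tau>. \<exists>g b. g \<in> class_A \<and> has_coeffs g b \<and>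
         (\<lambda>k. weight \<alpha> \<beta> \<tau> (k + 2) * cmod (b (k + 2))) sums K \<and> \<not> SC_ineq \<alpha> \<beta> \<tau> g"
  proof (intro allI impI)
    fix K assume K: "K > (1 - \<alpha>) * cmod \<tau>"
    obtain n where n: "n \<ge> 2"
      and not: "\<not> SC_ineq \<alpha> \<beta> \<tau> (\<lambda>z. z + of_real (K / weight \<alpha> \<beta> \<tau> n) * z ^ n)"
      using bound_sharp [OF _ _ _ K] assms by blast
    \<comment> \<open>Dividing by the weight makes the one-term weighted sum equal to K, as K is
      positive.\<close>
    define t where "t = complex_of_real (K / weight \<alpha> \<beta> \<tau> n)"
    have w: "weight \<alpha> \<beta> \<tau> n > 0" using assms n by (intro weight_pos)
    have "(1 - \<alpha>) * cmod \<tau> \<ge> 0" using assms by simp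
    then have "weight \<alpha> \<beta> \<tau> n * cmod t = K"
      using w K unfolding t_def norm_of_real by simp
    then show "\<exists>g b. g \<in> class_A \<and> has_coeffs g b \<and>
         (\<lambda>k. weight \<alpha> \<beta> \<tau> (k + 2) * cmod (b (k + 2))) sums K \<and> \<not> SC_ineq \<alpha> \<beta> \<tau> g"
      using binomial_class_A [OF n, of t] binomial_has_coeffs [OF n, of t]
        binomial_weight_sums [OF n, of \<alpha> \<beta> \<tau> t] not [folded t_def]
      by (intro exI [of _ "\<lambda>z. z + t * z ^ n"] exI [of _ "\<lambda>k. if k = n then t else 0"]) simp
  qed
qed

end
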